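(* Let $K$ be a compact zerodimensional space carrying a non-separable measure $\mu$, and let $f\colon K\to 2^\omega$ be a continuous mapping. Then there is $t\in 2^\omega$ such that $f^{-1}(t)=f^{-1}[\{t\}]$ is not scattered.
   Context: A measure on a compact space means a Radon probability measure on its Borel sets. A family $\mathcal{E}$ of measurable sets approximates $\mu$ if $\inf\{\mu(A\triangle E)\colon E\in\mathcal{E}\}=0$ for every $\mu$-measurable $A$; $\mu$ is separable if some countable family approximates it, non-separable otherwise. "Carries" does not require strict positivity. *)

theory Defs
  imports "HOL-Probability.Probability"
begin

definition zerodimensional_space :: "'a topology \<Rightarrow> bool" where
  "zerodimensional_space X \<longleftrightarrow> neighbourhood_base_of (\<lambda>U. openin X U \<and> closedin X U) X"

definition scattered_space :: "'a topology \<Rightarrow> bool" where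
  "scattered_space X \<longleftrightarrow>
     (\<forall>S. S \<subseteq> topspace X \<and> S \<noteq> {} \<longrightarrow> (\<exists>x\<in>S. openin (subtopology X S) {x}))"

definition radon_prob_measure :: "'a topology \<Rightarrow> 'a measure \<Rightarrow> bool" where
  "radon_prob_measure X M \<longleftrightarrow>
     prob_space M \<and>
     space M = topspace X \<and>
     sets M = sigma_sets (topspace X) {U. openin X U} \<and>
     (\<forall>A\<in>sets M. emeasure M A = (SUP C\<in>{C. compactin X C \<and> C \<in> sets M \<and> C \<subseteq> A}. emeasure M C))"

text \<open>
  The \<open>M\<close>-measurable sets are those of the completion of \<open>M\<close>. The infimum is taken in
  \<^typ>\<open>ennreal\<close>, so that the empty family approximates no measure.
\<close>

definition approximates_measure :: "'a set set \<Rightarrow> 'a measure \<Rightarrow> bool" where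
  "approximates_measure \<E> M \<longleftrightarrow>
     \<E> \<subseteq> sets (completion M) \<and>
     (\<forall>A\<in>sets (completion M). (INF E\<in>\<E>. emeasure (completion M) ((A - E) \<union> (E - A))) = 0)"

definition separable_measure :: "'a measure \<Rightarrow> bool" where
  "separable_measure M \<longleftrightarrow> (\<exists>\<E>. countable \<E> \<and> approximates_measure \<E> M)"

definition cantor_space :: "(nat \<Rightarrow> bool) topology" where
  "cantor_space = product_topology (\<lambda>_. discrete_topology UNIV) UNIV"

end

theory Submission
  imports Defs
begin

text \<open>
  Let \<open>F\<close> be the countably generated \<open>\<sigma>\<close>-algebra pulled back along \<open>f\<close>. Since \<open>M\<close> is not
  separable, there is a set \<open>C\<close> of positive measure on which \<open>M\<close> is atomless relative to \<open>F\<close>.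
  Hence every \<open>L \<subseteq> C\<close> splits into two parts, each of which charges almost all the fibres charged
  by \<open>L\<close>. Splitting repeatedly and shrinking to compact sets by inner regularity yields a binary
  tree of compact sets whose images under \<open>f\<close> have a common point \<open>t\<close>, because only little measure is
  lost at each node. All sets of the tree meet the fibre over \<open>t\<close>, and a minimal closed subset of
  that fibre meeting all of them has no isolated point.
\<close>

section \<open>Measure algebras\<close>

text \<open>Exhaustion: the union of a sequence of members whose measures approach the supremum
  attains that supremum, which is finite. Any further member can then add only a null set.\<close>

lemma (in finite_measure) largest_member_mod_null:
  assumes "\<Z> \<subseteq> sets M" and "{} \<in> \<Z>"
    and closed: "\<And>Z :: nat \<Rightarrow> 'a set. range Z \<subseteq> \<Z> \<Longrightarrow> (\<Union>n. Z n) \<in> \<Z>"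
  obtains Z where "Z \<in> \<Z>" and "\<And>W. W \<in> \<Z> \<Longrightarrow> W - Z \<in> null_sets M"
proof -
  have "\<Z> \<noteq> {}" using assms(2) by auto
  from ennreal_SUP_countable_SUP[OF this, of "emeasure M"]
  obtain y :: "nat \<Rightarrow> ennreal"
    where y: "range y \<subseteq> emeasure M ` \<Z>" "Sup (emeasure M ` \<Z>) = Sup (range y)" by auto
  then have "\<forall>n. \<exists>Z. Z \<in> \<Z> \<and> y n = emeasure M Z" by blast
  then obtain Z where Z: "\<And>n. Z n \<in> \<Z>" "\<And>n. y n = emeasure M (Z n)" by metis
  define V where "V = (\<Union>n. Z n)"
  have V: "V \<in> \<Z>" unfolding V_def using Z(1) by (intro closed) auto
  have "y n \<le> emeasure M V" for n
    unfolding Z(2) V_def using Z(1) assms(1) by (intro emeasure_mono) auto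
  then have max: "Sup (emeasure M ` \<Z>) \<le> emeasure M V"
    unfolding y(2) by (auto intro: SUP_least)
  have "W - V \<in> null_sets M" if W: "W \<in> \<Z>" for W
  proof -
    \<comment> \<open>Closure is assumed for sequences only, so the union of \<open>V\<close> and
      \<open>W\<close> is written as one.\<close>
    have "(\<Union>n::nat. if n = 0 then W else V) \<in> \<Z>"
      using V W by (intro closed) auto
    moreover have "(\<Union>n::nat. if n = 0 then W else V) = V \<union> (W - V)"
      by (auto split: if_splits)
    ultimately have "emeasure M (V \<union> (W - V)) \<le> emeasure M V"
      using max SUP_upper order_trans by metis
    moreover have "V \<in> sets M" "W \<in> sets M" using V W assms(1) by auto
    then have "emeasure M (V \<union> (W - V)) = emeasure M V + emeasure M (W - V)"
      by (subst plus_emeasure) auto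
    ultimately have "emeasure M (W - V) = 0"
      by (metis add.right_neutral emeasure_finite ennreal_add_left_cancel_le le_zero_eq infinity_ennreal_def)
    then show ?thesis using \<open>V \<in> sets M\<close> \<open>W \<in> sets M\<close> by auto
  qed
  with V show thesis by (rule that)
qed

text \<open>This localises separability to \<open>D\<close>: the measure algebra below
  \<open>D\<close> lies in a countably generated one. The generators may stick out of
  \<open>D\<close>, so one fixed family, joined by \<open>D\<close> itself, can serve for various
  \<open>D\<close>.\<close>

definition countably_generated_on :: "'a measure \<Rightarrow> 'a set \<Rightarrow> bool" where
  "countably_generated_on M D \<longleftrightarrow> (\<exists>\<E>. countable \<E> \<and> \<E> \<subseteq> sets M \<and>
     (\<forall>A\<in>sets M. A \<subseteq> D \<longrightarrow> (\<exists>B\<in>sigma_sets (space M) \<E>. sym_diff A B \<in> null_sets M)))"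

text \<open>The generating families are pooled. Each \<open>A \<inter> D n\<close> is matched up to
  a null set by some \<open>B n\<close>, and the countably many null errors add up to a null
  set.\<close>

lemma countably_generated_on_UN:
  fixes D :: "nat \<Rightarrow> 'a set"
  assumes D: "\<And>n. D n \<in> sets M" and cg: "\<And>n. countably_generated_on M (D n)"
  shows "countably_generated_on M (\<Union>n. D n)"
proof -
  obtain \<E> where \<E>: "\<And>n. countable (\<E> n)" "\<And>n. \<E> n \<subseteq> sets M"
    "\<And>n A. A \<in> sets M \<Longrightarrow> A \<subseteq> D n \<Longrightarrow>
       \<exists>B\<in>sigma_sets (space M) (\<E> n). sym_diff A B \<in> null_sets M"
    using cg unfolding countably_generated_on_def by metis
  have "\<exists>B\<in>sigma_sets (space M) (\<Union>n. \<E> n). sym_diff A B \<in> null_sets M"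
    if A: "A \<in> sets M" "A \<subseteq> (\<Union>n. D n)" for A
  proof -
    have "\<forall>n. \<exists>B\<in>sigma_sets (space M) (\<E> n). sym_diff (A \<inter> D n) B \<in> null_sets M"
      using \<E>(3) A(1) D by auto
    then obtain B where B: "\<And>n. B n \<in> sigma_sets (space M) (\<E> n)"
      "\<And>n. sym_diff (A \<inter> D n) (B n) \<in> null_sets M" by metis
    have Bs: "B n \<in> sigma_sets (space M) (\<Union>n. \<E> n)" for n
      using B(1)[of n] sigma_sets_mono'[of "\<E> n" "\<Union>n. \<E> n" "space M"] by auto
    have BM: "B n \<in> sets M" for n
      using B(1)[of n] \<E>(2)[of n] sets.sigma_sets_subset by blast
    have "sym_diff A (\<Union>n. B n) \<in> null_sets M"
    proof (rule null_sets_subset)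
      show "(\<Union>n. sym_diff (A \<inter> D n) (B n)) \<in> null_sets M"
        using B(2) by (rule null_sets_UN)
      show "sym_diff A (\<Union>n. B n) \<subseteq> (\<Union>n. sym_diff (A \<inter> D n) (B n))"
        using A(2) by blast
    qed (use A(1) BM in auto)
    moreover have "(\<Union>n. B n) \<in> sigma_sets (space M) (\<Union>n. \<E> n)"
      using Bs by (rule sigma_sets.Union)
    ultimately show ?thesis by blast
  qed
  then show ?thesis
    unfolding countably_generated_on_def using \<E>(1,2)
    by (intro exI[of _ "\<Union>n. \<E> n"]) auto
qed

text \<open>One round \<open>st\<close> of complements and pairwise unions preserves countability,
  and countably many rounds suffice: the stages increase, so two sets share a stage and their union
  appears in the next one.\<close>

lemma countable_generated_algebra:
  assumes "countable \<E>" and "\<E> \<subseteq> sets M"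
  obtains \<G> where "countable \<G>" "\<E> \<subseteq> \<G>" "\<G> \<subseteq> sets M" "{} \<in> \<G>"
    "\<And>A. A \<in> \<G> \<Longrightarrow> space M - A \<in> \<G>" "\<And>A B. A \<in> \<G> \<Longrightarrow> B \<in> \<G> \<Longrightarrow> A \<union> B \<in> \<G>"
proof -
  define st where "st \<H> = \<H> \<union> (\<lambda>A. space M - A) ` \<H> \<union> (\<lambda>(A, B). A \<union> B) ` (\<H> \<times> \<H>)" for \<H>
  define \<H> where "\<H> n = (st ^^ n) (insert {} \<E>)" for n
  have \<H>Suc: "\<H> (Suc n) = st (\<H> n)" for n by (simp add: \<H>_def)
  have cnt: "countable (\<H> n)" for n
    by (induction n) (auto simp: \<H>Suc st_def, auto simp: \<H>_def assms(1))
  have sub: "\<H> n \<subseteq> sets M" for n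
    by (induction n) (auto simp: \<H>Suc st_def, use assms(2) in \<open>auto simp: \<H>_def\<close>)
  have zero: "insert {} \<E> \<subseteq> \<H> 0" by (simp add: \<H>_def)
  show thesis
  proof (rule that[of "\<Union>n. \<H> n"])
    show "space M - A \<in> (\<Union>n. \<H> n)" if A: "A \<in> (\<Union>n. \<H> n)" for A
    proof -
      obtain n where "A \<in> \<H> n" using A by auto
      then have "space M - A \<in> \<H> (Suc n)" by (auto simp: \<H>Suc st_def)
      then show ?thesis by blast
    qed
    show "A \<union> B \<in> (\<Union>n. \<H> n)" if AB: "A \<in> (\<Union>n. \<H> n)" "B \<in> (\<Union>n. \<H> n)" for A B
    proof -
      have "incseq \<H>" by (intro incseq_SucI) (auto simp: \<H>Suc st_def)
      moreover obtain m n where "A \<in> \<H> m" "B \<in> \<H> n" using AB by auto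
      ultimately have "A \<in> \<H> (max m n)" "B \<in> \<H> (max m n)"
        by (meson incseqD max.cobounded1 max.cobounded2 subsetD)+
      then have "A \<union> B \<in> \<H> (Suc (max m n))" unfolding \<H>Suc st_def by force
      then show ?thesis by blast
    qed
    show "countable (\<Union>n. \<H> n)" using cnt by auto
    show "(\<Union>n. \<H> n) \<subseteq> sets M" using sub by blast
    show "\<E> \<subseteq> (\<Union>n. \<H> n)" "{} \<in> (\<Union>n. \<H> n)" using zero by blast+
  qed
qed

text \<open>The approximable sets form a \<sigma>-algebra: complements leave symmetric differences
  unchanged, finite unions at most add up errors, and countable unions are limits in measure of
  finite ones. This turns generation into the density that separability asks for.\<close>

lemma (in finite_measure) approximation_by_algebra:
  assumes \<G>: "\<G> \<subseteq> sets M" "{} \<in> \<G>"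
    "\<And>A. A \<in> \<G> \<Longrightarrow> space M - A \<in> \<G>" "\<And>A B. A \<in> \<G> \<Longrightarrow> B \<in> \<G> \<Longrightarrow> A \<union> B \<in> \<G>"
    and A: "A \<in> sigma_sets (space M) \<G>" and "e > 0"
  shows "\<exists>E\<in>\<G>. measure M (sym_diff A E) < e"
proof -
  define appr where "appr A \<longleftrightarrow> (\<forall>e>0. \<exists>E\<in>\<G>. measure M (sym_diff A E) < e)" for A
  have sig: "B \<in> sets M" if "B \<in> sigma_sets (space M) \<G>" for B
    using that \<G>(1) sets.sigma_sets_subset by blast
  \<comment> \<open>Approximability passes to limits in measure, by the triangle inequality for
    symmetric differences.\<close>
  have appr_if_close: "appr A"
    if A: "A \<in> sets M" and close: "\<And>e. e > 0 \<Longrightarrow> \<exists>B\<in>sets M. appr B \<and> measure M (sym_diff A B) < e"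
    for A
    unfolding appr_def
  proof (intro allI impI)
    fix e :: real assume "e > 0"
    then obtain B where B: "B \<in> sets M" "appr B" "measure M (sym_diff A B) < e / 2"
      using close[of "e / 2"] by auto
    then obtain E where E: "E \<in> \<G>" "measure M (sym_diff B E) < e / 2"
      using \<open>e > 0\<close> unfolding appr_def by (meson half_gt_zero)
    have "measure M (sym_diff A E) \<le> measure M (sym_diff A B \<union> sym_diff B E)"
      using A B(1) E(1) \<G>(1) by (intro finite_measure_mono) auto
    also have "\<dots> \<le> measure M (sym_diff A B) + measure M (sym_diff B E)"
      using A B(1) E(1) \<G>(1) by (intro measure_Un_le) auto
    finally show "\<exists>E\<in>\<G>. measure M (sym_diff A E) < e" using B(3) E by force
  qed
  have appr_Un: "appr (A \<union> B)" if AB: "appr A" "appr B" "A \<in> sets M" "B \<in> sets M" for A B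
    unfolding appr_def
  proof (intro allI impI)
    fix e :: real assume "e > 0"
    then obtain C D where CD: "C \<in> \<G>" "measure M (sym_diff A C) < e / 2"
      "D \<in> \<G>" "measure M (sym_diff B D) < e / 2"
      using AB(1,2) unfolding appr_def by (meson half_gt_zero)
    have "measure M (sym_diff (A \<union> B) (C \<union> D)) \<le> measure M (sym_diff A C \<union> sym_diff B D)"
      using AB CD(1,3) \<G>(1) by (intro finite_measure_mono) auto
    also have "\<dots> \<le> measure M (sym_diff A C) + measure M (sym_diff B D)"
      using AB CD(1,3) \<G>(1) by (intro measure_Un_le) auto
    finally show "\<exists>E\<in>\<G>. measure M (sym_diff (A \<union> B) E) < e"
      using CD \<G>(4) by force
  qed
  have appr_\<G>: "appr A" if "A \<in> \<G>" for A
    unfolding appr_def using that by (auto intro!: bexI[of _ A])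
  have "appr A" using A
  proof (induction rule: sigma_sets.induct)
    case (Basic A)
    then show ?case by (rule appr_\<G>)
  next
    case Empty
    show ?case using \<G>(2) by (rule appr_\<G>)
  next
    case (Compl A)
    show ?case unfolding appr_def
    proof (intro allI impI)
      fix e :: real assume "e > 0"
      then obtain E where E: "E \<in> \<G>" "measure M (sym_diff A E) < e"
        using Compl.IH unfolding appr_def by auto
      have "sym_diff (space M - A) (space M - E) = sym_diff A E"
        using E(1) \<G>(1) sig[OF Compl.hyps] sets.sets_into_space by blast
      then show "\<exists>E\<in>\<G>. measure M (sym_diff (space M - A) E) < e"
        using E \<G>(3) by metis
    qed
  next
    case (Union A)
    have As: "A n \<in> sets M" for n using Union.hyps sig by auto
    have fin: "appr (\<Union>i<n. A i)" for n
    proof (induction n)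
      case 0 then show ?case using appr_\<G>[OF \<G>(2)] by simp
    next
      case (Suc n)
      then show ?case
        using appr_Un[OF Suc Union.IH[of n]] As by (auto simp: lessThan_Suc Un_commute)
    qed
    show ?case
    proof (rule appr_if_close)
      fix e :: real assume "e > 0"
      have "(\<lambda>n. measure M (\<Union>i<n. A i)) \<longlonglongrightarrow> measure M (\<Union>n. \<Union>i<n. A i)"
        using As by (intro finite_Lim_measure_incseq) (auto simp: incseq_def, fastforce)
      moreover have eq: "(\<Union>n. \<Union>i<n. A i) = (\<Union>n. A n)" by auto
      ultimately have "\<forall>\<^sub>F n in sequentially. measure M (\<Union>i<n. A i) > measure M (\<Union>n. A n) - e"
        using \<open>e > 0\<close> by (intro order_tendstoD(1)) auto
      then obtain n where n: "measure M (\<Union>i<n. A i) > measure M (\<Union>n. A n) - e"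
        using eventually_happens by force
      have "sym_diff (\<Union>n. A n) (\<Union>i<n. A i) = (\<Union>n. A n) - (\<Union>i<n. A i)" by auto
      then have "measure M (sym_diff (\<Union>n. A n) (\<Union>i<n. A i)) < e"
        using n As by (simp add: finite_measure_Diff UN_mono)
      then show "\<exists>B\<in>sets M. appr B \<and> measure M (sym_diff (\<Union>n. A n) B) < e"
        using fin[of n] As by (intro bexI[of _ "\<Union>i<n. A i"]) auto
    qed (use As in auto)
  qed
  then show ?thesis using \<open>e > 0\<close> unfolding appr_def by auto
qed

text \<open>A set of the completion differs by a null set from a set of \<open>M\<close>, hence from
  one generated by \<open>\<E>\<close>; the countable algebra \<open>\<G>\<close> around
  \<open>\<E>\<close> is dense among the latter.\<close>

lemma (in finite_measure) separable_measureI: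
  assumes "countably_generated_on M (space M)"
  shows "separable_measure M"
proof -
  obtain \<E> where \<E>: "countable \<E>" "\<E> \<subseteq> sets M"
    "\<And>A. A \<in> sets M \<Longrightarrow> \<exists>B\<in>sigma_sets (space M) \<E>. sym_diff A B \<in> null_sets M"
    using assms sets.sets_into_space unfolding countably_generated_on_def by metis
  obtain \<G> where \<G>: "countable \<G>" "\<E> \<subseteq> \<G>" "\<G> \<subseteq> sets M" "{} \<in> \<G>"
    "\<And>A. A \<in> \<G> \<Longrightarrow> space M - A \<in> \<G>" "\<And>A B. A \<in> \<G> \<Longrightarrow> B \<in> \<G> \<Longrightarrow> A \<union> B \<in> \<G>"
    using countable_generated_algebra[OF \<E>(1,2)] by metis
  have "(INF E\<in>\<G>. emeasure (completion M) (sym_diff A E)) = 0"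
    if A: "A \<in> sets (completion M)" for A
  proof -
    obtain S N N' where S: "A = S \<union> N" "N \<subseteq> N'" "N' \<in> null_sets M" "S \<in> sets M"
      using sets_completionE[OF A] by metis
    obtain B where B: "B \<in> sigma_sets (space M) \<E>" "sym_diff S B \<in> null_sets M"
      using \<E>(3)[OF S(4)] by auto
    have BG: "B \<in> sigma_sets (space M) \<G>"
      using B(1) sigma_sets_mono'[OF \<G>(2)] by auto
    have Bs: "B \<in> sets M" using BG \<G>(3) sets.sigma_sets_subset by blast
    have "(INF E\<in>\<G>. emeasure (completion M) (sym_diff A E)) \<le> ennreal e" if "e > 0" for e :: real
    proof -
      obtain E where E: "E \<in> \<G>" "measure M (sym_diff B E) < e"
        using approximation_by_algebra[OF \<G>(3-6) BG \<open>e > 0\<close>] by auto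
      have Es: "E \<in> sets M" using E(1) \<G>(3) by auto
      have N: "sym_diff S B \<union> N' \<in> null_sets M" using B(2) S(3) by auto
      have "emeasure (completion M) (sym_diff A E)
          \<le> emeasure (completion M) (sym_diff B E \<union> (sym_diff S B \<union> N'))"
        using S(1,2) Es Bs N by (intro emeasure_mono) auto
      also have "\<dots> = emeasure M (sym_diff B E \<union> (sym_diff S B \<union> N'))"
        using Es Bs N by (subst emeasure_completion) auto
      also have "\<dots> = emeasure M (sym_diff B E)"
        using Es Bs N by (intro emeasure_Un_null_set) auto
      also have "\<dots> \<le> ennreal e"
        using E(2) \<open>e > 0\<close> by (simp add: emeasure_eq_measure)
      finally show ?thesis using E(1) by (meson INF_lower2)
    qed
    then have "(INF E\<in>\<G>. emeasure (completion M) (sym_diff A E)) \<le> 0"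
      using ennreal_le_epsilon[of 0] by (metis add_0)
    then show ?thesis by (metis le_zero_eq)
  qed
  moreover have "\<G> \<subseteq> sets (completion M)" using \<G>(3) by auto
  ultimately show ?thesis
    unfolding separable_measure_def approximates_measure_def using \<G>(1) by blast
qed

section \<open>Localising non-separability to a relatively atomless part\<close>

text \<open>The last property says that \<open>M\<close> is atomless relative to \<open>F\<close> on \<open>C\<close>.\<close>

lemma (in finite_measure_subalgebra) nonseparable_relatively_atomless_part:
  assumes "\<not> separable_measure M"
    and \<U>: "countable \<U>" "\<U> \<subseteq> sets M" "sets F \<subseteq> sigma_sets (space M) \<U>"
  obtains C where "C \<in> sets M" "C \<notin> null_sets M"
    and "\<And>D. D \<in> sets M \<Longrightarrow> D \<subseteq> C \<Longrightarrow> D \<notin> null_sets M \<Longrightarrow>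
           \<exists>A\<in>sets M. A \<subseteq> D \<and> (\<forall>E\<in>sets F. sym_diff A (D \<inter> E) \<notin> null_sets M)"
proof -
  \<comment> \<open>\<open>Z\<close> is the largest part, up to null sets, on which \<open>M\<close>
    is countably generated; its complement will be \<open>C\<close>.\<close>
  obtain Z where Z: "Z \<in> sets M" "countably_generated_on M Z"
    and max: "\<And>W. W \<in> sets M \<Longrightarrow> countably_generated_on M W \<Longrightarrow> W - Z \<in> null_sets M"
  proof (rule largest_member_mod_null[of "{D \<in> sets M. countably_generated_on M D}"])
    show "{} \<in> {D \<in> sets M. countably_generated_on M D}"
      unfolding countably_generated_on_def
      by (auto intro!: exI[of _ "{}"] bexI[of _ "{}"] sigma_sets.Empty)
  qed (auto intro!: countably_generated_on_UN)
  show thesis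
  proof (rule that[of "space M - Z"])
    show "space M - Z \<in> sets M" using Z by auto
    show "space M - Z \<notin> null_sets M"
    proof
      \<comment> \<open>In this case generators for \<open>Z\<close> would do for the whole space
        and make \<open>M\<close> separable.\<close>
      assume null: "space M - Z \<in> null_sets M"
      obtain \<E> where \<E>: "countable \<E>" "\<E> \<subseteq> sets M"
        "\<And>A. A \<in> sets M \<Longrightarrow> A \<subseteq> Z \<Longrightarrow> \<exists>B\<in>sigma_sets (space M) \<E>. sym_diff A B \<in> null_sets M"
        using Z(2) unfolding countably_generated_on_def by metis
      have "\<exists>B\<in>sigma_sets (space M) \<E>. sym_diff A B \<in> null_sets M" if A: "A \<in> sets M" for A
      proof -
        obtain B where B: "B \<in> sigma_sets (space M) \<E>" "sym_diff (A \<inter> Z) B \<in> null_sets M"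
          using \<E>(3)[of "A \<inter> Z"] A Z(1) by auto
        have BM: "B \<in> sets M" using B(1) \<E>(2) sets.sigma_sets_subset by blast
        have "sym_diff A B \<in> null_sets M"
        proof (rule null_sets_subset)
          show "(space M - Z) \<union> sym_diff (A \<inter> Z) B \<in> null_sets M"
            using null B(2) by auto
          show "sym_diff A B \<subseteq> (space M - Z) \<union> sym_diff (A \<inter> Z) B"
            using sets.sets_into_space[OF A] by auto
        qed (use A BM in auto)
        with B(1) show ?thesis by blast
      qed
      then have "countably_generated_on M (space M)"
        unfolding countably_generated_on_def using \<E>(1,2) by blast
      with separable_measureI assms(1) show False by blast
    qed
    show "\<exists>A\<in>sets M. A \<subseteq> D \<and> (\<forall>E\<in>sets F. sym_diff A (D \<inter> E) \<notin> null_sets M)"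
      if D: "D \<in> sets M" "D \<subseteq> space M - Z" "D \<notin> null_sets M" for D
    proof (rule ccontr)
      \<comment> \<open>Now every measurable subset of \<open>D\<close> is a trace
        \<open>D \<inter> E\<close> up to a null set, so \<open>\<U>\<close> together with
        \<open>D\<close> generates everything below \<open>D\<close>. Maximality puts
        \<open>D\<close> almost inside \<open>Z\<close>, yet \<open>D\<close> is disjoint from
        \<open>Z\<close> and not null.\<close>
      assume "\<not> ?thesis"
      then have tr: "\<exists>E\<in>sets F. sym_diff A (D \<inter> E) \<in> null_sets M" if "A \<in> sets M" "A \<subseteq> D" for A
        using that by blast
      have "\<exists>B\<in>sigma_sets (space M) (insert D \<U>). sym_diff A B \<in> null_sets M"
        if A: "A \<in> sets M" "A \<subseteq> D" for A
      proof -
        obtain E where E: "E \<in> sets F" "sym_diff A (D \<inter> E) \<in> null_sets M"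
          using tr[OF A] by auto
        have "insert D \<U> \<subseteq> Pow (space M)"
          using D(1) \<U>(2) sets.sets_into_space by blast
        then interpret sigma_algebra "space M" "sigma_sets (space M) (insert D \<U>)"
          by (rule sigma_algebra_sigma_sets)
        have "E \<in> sigma_sets (space M) (insert D \<U>)"
          using E(1) \<U>(3) sigma_sets_mono'[of \<U> "insert D \<U>" "space M"] by auto
        then have "D \<inter> E \<in> sigma_sets (space M) (insert D \<U>)"
          by (intro Int) auto
        with E(2) show ?thesis by blast
      qed
      then have "countably_generated_on M D"
        unfolding countably_generated_on_def using \<U>(1,2) D(1)
        by (intro exI[of _ "insert D \<U>"]) auto
      from max[OF D(1) this] have "D - Z \<in> null_sets M" .
      moreover have "D - Z = D" using D(2) by auto
      ultimately show False using D(3) by simp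
    qed
  qed
qed


section \<open>Sets covering a member of a sub-\<open>\<sigma>\<close>-algebra\<close>

text \<open>With \<open>F\<close> the \<open>\<sigma>\<close>-algebra pulled back along a map \<open>f\<close>, this says that almost every
  fibre over \<open>E\<close> is charged by \<open>L\<close>; it replaces a disintegration of \<open>M\<close> along \<open>f\<close>.\<close>

definition covers :: "'a measure \<Rightarrow> 'a measure \<Rightarrow> 'a set \<Rightarrow> 'a set \<Rightarrow> bool" where
  "covers M F L E \<longleftrightarrow> (\<forall>D\<in>sets F. D \<subseteq> E \<longrightarrow> L \<inter> D \<in> null_sets M \<longrightarrow> D \<in> null_sets M)"

lemma covers_subset: "covers M F L E \<Longrightarrow> E' \<subseteq> E \<Longrightarrow> covers M F L E'"
  unfolding covers_def by (meson order_trans)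

lemma covers_cong: "L \<inter> E = L' \<inter> E \<Longrightarrow> covers M F L E = covers M F L' E"
proof -
  assume eq: "L \<inter> E = L' \<inter> E"
  have "L \<inter> D = L' \<inter> D" if "D \<subseteq> E" for D using eq that by blast
  then show ?thesis unfolding covers_def by metis
qed

context finite_measure_subalgebra
begin

lemma sets_F_M: "A \<in> sets F \<Longrightarrow> A \<in> sets M"
  using subalg by (auto simp: subalgebra_def)

lemma covers_mono:
  assumes "covers M F L E" and "L \<subseteq> L'" and "L \<in> sets M"
  shows "covers M F L' E"
  unfolding covers_def
proof (intro ballI impI)
  fix D assume D: "D \<in> sets F" "D \<subseteq> E" "L' \<inter> D \<in> null_sets M"
  have "L \<inter> D \<in> null_sets M"
    using D(3) by (rule null_sets_subset) (use assms(2,3) sets_F_M[OF D(1)] in auto)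
  then show "D \<in> null_sets M" using assms(1) D unfolding covers_def by blast
qed

text \<open>A test set \<open>D\<close> is cut into the pieces \<open>D \<inter> E i\<close>; each
  is null, and there are countably many.\<close>

lemma covers_UN:
  fixes E :: "'i :: countable \<Rightarrow> 'a set"
  assumes "\<And>i. covers M F L (E i)" and "\<And>i. E i \<in> sets F" and "L \<in> sets M"
  shows "covers M F L (\<Union>i. E i)"
  unfolding covers_def
proof (intro ballI impI)
  fix D assume D: "D \<in> sets F" "D \<subseteq> (\<Union>i. E i)" "L \<inter> D \<in> null_sets M"
  have "D \<inter> E i \<in> null_sets M" for i
  proof -
    have "L \<inter> (D \<inter> E i) \<in> null_sets M"
      using D(3) by (rule null_sets_subset)
        (use assms(3) sets_F_M[OF D(1)] sets_F_M[OF assms(2)[of i]] in auto)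
    then show ?thesis
      using assms(1)[of i] assms(2)[of i] D(1) unfolding covers_def by (meson Int_lower2 sets.Int)
  qed
  then have "(\<Union>i. D \<inter> E i) \<in> null_sets M" by (rule null_sets_UN)
  moreover have "(\<Union>i. D \<inter> E i) = D" using D(2) by blast
  ultimately show "D \<in> null_sets M" by simp
qed

lemma covers_mod_null:
  assumes "covers M F L Z" and "E - Z \<in> null_sets M" and "Z \<in> sets F" and "L \<in> sets M"
  shows "covers M F L E"
  unfolding covers_def
proof (intro ballI impI)
  fix D assume D: "D \<in> sets F" "D \<subseteq> E" "L \<inter> D \<in> null_sets M"
  have "L \<inter> (D \<inter> Z) \<in> null_sets M"
    using D(3) by (rule null_sets_subset)
      (use assms(4) sets_F_M[OF D(1)] sets_F_M[OF assms(3)] in auto)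
  then have "D \<inter> Z \<in> null_sets M"
    using assms(1,3) D(1) unfolding covers_def by (meson Int_lower2 sets.Int)
  moreover have "D - Z \<in> null_sets M"
    using assms(2) by (rule null_sets_subset)
      (use D(2) sets_F_M[OF D(1)] sets_F_M[OF assms(3)] in auto)
  ultimately have "(D \<inter> Z) \<union> (D - Z) \<in> null_sets M" by (rule null_sets.Un)
  moreover have "(D \<inter> Z) \<union> (D - Z) = D" by auto
  ultimately show "D \<in> null_sets M" by simp
qed

text \<open>The set \<open>E - S\<close> is itself a test set, and it is disjoint from
  \<open>L\<close>.\<close>

lemma covers_superset_null:
  assumes "covers M F L E" and "E \<in> sets F" and "S \<in> sets F" and "L \<subseteq> S"
  shows "E - S \<in> null_sets M"
proof -
  have "L \<inter> (E - S) = {}" using assms(4) by auto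
  then show ?thesis using assms unfolding covers_def
    by (metis Diff_subset null_sets.empty_sets sets.Diff)
qed

text \<open>\<open>S\<close> is the complement of the largest member of \<open>F\<close> that meets
  \<open>A\<close> in a null set. Up to null sets it is where the conditional probability of
  \<open>A\<close> given \<open>F\<close> is positive.\<close>

lemma exists_support:
  assumes A: "A \<in> sets M"
  obtains S where "S \<in> sets F" "A - S \<in> null_sets M" "covers M F A S"
proof -
  obtain Z where Z: "Z \<in> sets F" "A \<inter> Z \<in> null_sets M"
    and max: "\<And>W. W \<in> sets F \<Longrightarrow> A \<inter> W \<in> null_sets M \<Longrightarrow> W - Z \<in> null_sets M"
  proof (rule largest_member_mod_null[of "{Z \<in> sets F. A \<inter> Z \<in> null_sets M}"])
    fix Z :: "nat \<Rightarrow> 'a set" assume Z: "range Z \<subseteq> {Z \<in> sets F. A \<inter> Z \<in> null_sets M}"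
    then have "(\<Union>n. A \<inter> Z n) \<in> null_sets M" by (intro null_sets_UN) auto
    then have "A \<inter> (\<Union>n. Z n) \<in> null_sets M" by (simp only: Int_UN_distrib)
    moreover have "(\<Union>n. Z n) \<in> sets F" using Z by (intro sets.countable_UN) auto
    ultimately show "(\<Union>n. Z n) \<in> {Z \<in> sets F. A \<inter> Z \<in> null_sets M}" by blast
  qed (auto intro: sets_F_M)
  have sp: "space F = space M" using subalg by (simp add: subalgebra_def)
  show thesis
  proof (rule that[of "space F - Z"])
    show "space F - Z \<in> sets F" using Z(1) by auto
    have "A - (space F - Z) = A \<inter> Z" using sets.sets_into_space[OF A] sp by auto
    then show "A - (space F - Z) \<in> null_sets M" using Z(2) by simp
    show "covers M F A (space F - Z)"
      unfolding covers_def
    proof (intro ballI impI)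
      fix D assume D: "D \<in> sets F" "D \<subseteq> space F - Z" "A \<inter> D \<in> null_sets M"
      then have "D - Z \<in> null_sets M" by (intro max)
      moreover have "D - Z = D" using D(2) by auto
      ultimately show "D \<in> null_sets M" by simp
    qed
  qed
qed

text \<open>Exhaustion over the parts of \<open>E\<close> above which \<open>L\<close> can be split.
  If the largest such part \<open>Z\<close> missed a non-null \<open>E - Z\<close>, a subset
  \<open>A\<close> of \<open>L\<close> over \<open>E - Z\<close> that is no trace of a member of
  \<open>F\<close> would split \<open>L\<close> over the non-null overlap of the supports of
  \<open>A\<close> and of its complement, enlarging \<open>Z\<close>.\<close>

lemma covers_split:
  assumes atomless: "\<And>D. D \<in> sets M \<Longrightarrow> D \<subseteq> L \<Longrightarrow> D \<notin> null_sets M \<Longrightarrow>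
           \<exists>A\<in>sets M. A \<subseteq> D \<and> (\<forall>E\<in>sets F. sym_diff A (D \<inter> E) \<notin> null_sets M)"
    and L: "L \<in> sets M" and E: "E \<in> sets F" and cov: "covers M F L E"
  obtains A where "A \<in> sets M" "A \<subseteq> L" "covers M F A E" "covers M F (L - A) E"
proof -
  define \<Z> where "\<Z> = {Z \<in> sets F. Z \<subseteq> E \<and>
    (\<exists>A\<in>sets M. A \<subseteq> L \<and> covers M F A Z \<and> covers M F (L - A) Z)}"
  have "{} \<in> \<Z>" unfolding \<Z>_def covers_def by auto
  have "(\<Union>n. Z n) \<in> \<Z>" if Z: "range Z \<subseteq> \<Z>" for Z :: "nat \<Rightarrow> 'a set"
  proof -
    have ZF: "Z n \<in> sets F" "Z n \<subseteq> E" for n using Z by (auto simp: \<Z>_def)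
    have "\<forall>n. \<exists>A\<in>sets M. A \<subseteq> L \<and> covers M F A (Z n) \<and> covers M F (L - A) (Z n)"
      using Z by (auto simp: \<Z>_def)
    then obtain A where A: "\<And>n. A n \<in> sets M" "\<And>n. A n \<subseteq> L"
      "\<And>n. covers M F (A n) (Z n)" "\<And>n. covers M F (L - A n) (Z n)" by metis
    let ?D = "disjointed Z"
    have D: "?D n \<in> sets F" "?D n \<subseteq> Z n" for n
      using sets.range_disjointed_sets[of Z F] ZF(1) disjointed_subset[of Z n] by auto
    \<comment> \<open>The splittings are glued along disjoint pieces, so that over
      \<open>?D n\<close> the set \<open>B\<close> is just \<open>A n\<close>.\<close>
    define B where "B = (\<Union>n. A n \<inter> ?D n)"
    have BM: "B \<in> sets M" unfolding B_def using A(1) sets_F_M[OF D(1)] by auto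
    have BD: "B \<inter> ?D n = A n \<inter> ?D n" for n
    proof -
      have "?D m \<inter> ?D n = {}" if "m \<noteq> n" for m
        using disjoint_family_disjointed[of Z] that by (auto simp: disjoint_family_on_def)
      then show ?thesis unfolding B_def by (auto, metis IntI empty_iff)
    qed
    have "covers M F B (?D n)" for n
      using covers_subset[OF A(3) D(2)] covers_cong[OF BD] by metis
    moreover have "covers M F (L - B) (?D n)" for n
    proof -
      have "(L - B) \<inter> ?D n = (L - A n) \<inter> ?D n" using BD[of n] by blast
      from covers_cong[OF this] show ?thesis using covers_subset[OF A(4) D(2)] by metis
    qed
    ultimately have "covers M F B (\<Union>n. ?D n)" "covers M F (L - B) (\<Union>n. ?D n)"
      using D(1) BM L by (auto intro!: covers_UN simp del: UN_simps)
    moreover have "B \<subseteq> L" unfolding B_def using A(2) by auto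
    ultimately show ?thesis
      unfolding \<Z>_def UN_disjointed_eq using ZF BM by auto
  qed
  moreover have "\<Z> \<subseteq> sets M" unfolding \<Z>_def using sets_F_M by auto
  ultimately obtain Z where Z: "Z \<in> \<Z>" and max: "\<And>W. W \<in> \<Z> \<Longrightarrow> W - Z \<in> null_sets M"
    using largest_member_mod_null[of \<Z>] \<open>{} \<in> \<Z>\<close> by metis
  have ZF: "Z \<in> sets F" using Z by (simp add: \<Z>_def)
  have null: "E - Z \<in> null_sets M"
  proof (rule ccontr)
    assume pos: "E - Z \<notin> null_sets M"
    define G where "G = E - Z"
    define D where "D = L \<inter> G"
    have G: "G \<in> sets F" "G \<subseteq> E" unfolding G_def using E ZF by auto
    have D: "D \<in> sets M" "D \<subseteq> L" unfolding D_def using L sets_F_M[OF G(1)] by auto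
    have "D \<notin> null_sets M"
      using cov G pos unfolding covers_def D_def by (auto simp: G_def)
    from atomless[OF D this] obtain A where A: "A \<in> sets M" "A \<subseteq> D"
      "\<And>E. E \<in> sets F \<Longrightarrow> sym_diff A (D \<inter> E) \<notin> null_sets M" by auto
    obtain S where S: "S \<in> sets F" "A - S \<in> null_sets M" "covers M F A S"
      using exists_support[OF A(1)] .
    have "D - A \<in> sets M" using D A by auto
    then obtain T where T: "T \<in> sets F" "(D - A) - T \<in> null_sets M" "covers M F (D - A) T"
      using exists_support by blast
    have W: "S \<inter> T \<inter> G \<in> sets F" using S(1) T(1) G(1) by auto
    \<comment> \<open>If the supports had null overlap inside \<open>G\<close>, almost all of
      \<open>D \<inter> S\<close> would belong to \<open>A\<close>, and \<open>A\<close> would be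
      the trace of \<open>S\<close> on \<open>D\<close>.\<close>
    have "S \<inter> T \<inter> G \<notin> null_sets M"
    proof
      assume "S \<inter> T \<inter> G \<in> null_sets M"
      then have "(A - S) \<union> (((D - A) - T) \<union> (S \<inter> T \<inter> G)) \<in> null_sets M"
        using S(2) T(2) by auto
      then have "sym_diff A (D \<inter> S) \<in> null_sets M"
      proof (rule null_sets_subset)
        show "sym_diff A (D \<inter> S) \<in> sets M" using A(1) D(1) sets_F_M[OF S(1)] by auto
        show "sym_diff A (D \<inter> S) \<subseteq> (A - S) \<union> (((D - A) - T) \<union> (S \<inter> T \<inter> G))"
          using A(2) unfolding D_def by auto
      qed
      with A(3)[OF S(1)] show False by simp
    qed
    moreover have "covers M F A (S \<inter> T \<inter> G)" by (rule covers_subset[OF S(3)]) auto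
    moreover have "covers M F (L - A) (S \<inter> T \<inter> G)"
    proof (rule covers_mono)
      show "covers M F (D - A) (S \<inter> T \<inter> G)" by (rule covers_subset[OF T(3)]) auto
    qed (use D A in auto)
    then have "S \<inter> T \<inter> G \<in> \<Z>"
      unfolding \<Z>_def using W G(2) A(1,2) D(2) \<open>covers M F A (S \<inter> T \<inter> G)\<close> by blast
    then have "S \<inter> T \<inter> G - Z \<in> null_sets M" by (rule max)
    moreover have "S \<inter> T \<inter> G - Z = S \<inter> T \<inter> G" unfolding G_def by auto
    ultimately show False by simp
  qed
  obtain A where A: "A \<in> sets M" "A \<subseteq> L" "covers M F A Z" "covers M F (L - A) Z"
    using Z by (auto simp: \<Z>_def)
  show thesis
    using that[OF A(1,2)] covers_mod_null[OF A(3) null ZF A(1)]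
      covers_mod_null[OF A(4) null ZF] L A(1) by auto
qed

text \<open>Sets \<open>L n\<close> from \<open>\<C>\<close> exhaust \<open>A\<close> up to a null
  set, so their supports \<open>S n\<close> exhaust \<open>E\<close> up to a set \<open>D\<close>
  with \<open>A \<inter> D\<close> null, hence up to a null set. By continuity from above finitely
  many supports leave less than \<open>e\<close> of \<open>E\<close>, and the union of the
  corresponding \<open>L i\<close> is the required set.\<close>

lemma covers_inner_regular:
  assumes \<C>: "\<C> \<subseteq> sets M" "{} \<in> \<C>" "\<And>K L. K \<in> \<C> \<Longrightarrow> L \<in> \<C> \<Longrightarrow> K \<union> L \<in> \<C>"
    and inner: "\<And>A e. A \<in> sets M \<Longrightarrow> e > 0 \<Longrightarrow> \<exists>L\<in>\<C>. L \<subseteq> A \<and> measure M (A - L) < e"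
    and sat: "\<And>L. L \<in> \<C> \<Longrightarrow> sat L \<in> sets F" "\<And>L. L \<in> \<C> \<Longrightarrow> L \<subseteq> sat L"
    and A: "A \<in> sets M" and E: "E \<in> sets F" and cov: "covers M F A E" and e: "e > 0"
  obtains L E' where "L \<in> \<C>" "L \<subseteq> A" "E' \<in> sets F" "E' \<subseteq> E" "E' \<subseteq> sat L" "covers M F L E'"
    "measure M (E - E') < e"
proof -
  have "\<forall>n::nat. \<exists>L\<in>\<C>. L \<subseteq> A \<and> measure M (A - L) < inverse (Suc n)"
    using inner[OF A] by auto
  then obtain L where L: "\<And>n. L n \<in> \<C>" "\<And>n. L n \<subseteq> A"
    "\<And>n::nat. measure M (A - L n) < inverse (Suc n)" by metis
  have LM: "L n \<in> sets M" for n using L(1) \<C>(1) by auto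
  have "\<forall>n. \<exists>S. S \<in> sets F \<and> covers M F (L n) S \<and> L n - S \<in> null_sets M"
    using exists_support[OF LM] by metis
  then obtain S where S: "\<And>n. S n \<in> sets F" "\<And>n. covers M F (L n) (S n)"
    "\<And>n. L n - S n \<in> null_sets M" by metis
  define D where "D = E - (\<Union>n. S n)"
  have D: "D \<in> sets F" "D \<subseteq> E" unfolding D_def using E S(1) by auto
  have "measure M (A - (\<Union>n. L n)) \<le> inverse (Suc n)" for n
  proof -
    have "measure M (A - (\<Union>n. L n)) \<le> measure M (A - L n)"
      using A LM by (intro finite_measure_mono) auto
    then show ?thesis using L(3)[of n] by linarith
  qed
  then have "measure M (A - (\<Union>n. L n)) \<le> 0"
    using LIMSEQ_inverse_real_of_nat by (intro LIMSEQ_le_const) auto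
  then have rest: "A - (\<Union>n. L n) \<in> null_sets M"
    using A LM by (intro null_setsI) (auto simp: emeasure_eq_measure measure_le_0_iff)
  have "(\<Union>n. L n - S n) \<in> null_sets M" using S(3) by (rule null_sets_UN)
  with rest have "(A - (\<Union>n. L n)) \<union> (\<Union>n. L n - S n) \<in> null_sets M" by (rule null_sets.Un)
  then have "A \<inter> D \<in> null_sets M"
    by (rule null_sets_subset) (use A sets_F_M[OF D(1)] in \<open>auto simp: D_def\<close>)
  then have null: "D \<in> null_sets M" using cov D unfolding covers_def by blast
  have "(\<lambda>n. measure M (E - (\<Union>i<n. S i))) \<longlonglongrightarrow> measure M (\<Inter>n. E - (\<Union>i<n. S i))"
    using sets_F_M[OF E] sets_F_M[OF S(1)]
    by (intro finite_Lim_measure_decseq) (auto simp: decseq_def)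
  moreover have "(\<Inter>n. E - (\<Union>i<n. S i)) = D" unfolding D_def by auto
  moreover have "measure M D = 0" using null by (simp add: measure_eq_0_null_sets)
  ultimately have "\<forall>\<^sub>F n in sequentially. measure M (E - (\<Union>i<n. S i)) < e"
    using e by (intro order_tendstoD(2)) auto
  then obtain n where n: "measure M (E - (\<Union>i<n. S i)) < e"
    using eventually_happens by force
  define L' where "L' = (\<Union>i<n. L i)"
  define G where "G = E \<inter> (\<Union>i<n. S i)"
  have L': "L' \<in> \<C>" unfolding L'_def
  proof (induction n)
    case (Suc n)
    then show ?case using \<C>(3)[OF L(1)] by (simp add: lessThan_Suc)
  qed (simp add: \<C>(2))
  have G: "G \<in> sets F" unfolding G_def using E S(1) by auto
  have covG: "covers M F L' G"
  proof -
    \<comment> \<open>Padding with the empty set, which is covered trivially, makes the finite union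
      an instance of \<open>covers_UN\<close>.\<close>
    have "covers M F L' (if i < n then S i else {})" for i
      using covers_mono[OF S(2), of i L'] LM by (auto simp: L'_def, auto simp: covers_def)
    then have "covers M F L' (\<Union>i. if i < n then S i else {})"
      using S(1) L' \<C>(1) by (intro covers_UN) auto
    then show ?thesis by (rule covers_subset) (auto simp: G_def)
  qed
  show thesis
  proof (rule that[OF L'])
    show "L' \<subseteq> A" unfolding L'_def using L(2) by auto
    show "G \<inter> sat L' \<in> sets F" using G sat(1)[OF L'] by auto
    show "covers M F L' (G \<inter> sat L')" using covG by (rule covers_subset) auto
    \<comment> \<open>Cutting down to \<open>sat L'\<close> therefore costs no measure.\<close>
    have "G - sat L' \<in> null_sets M"
      using covers_superset_null[OF covG G sat(1)[OF L'] sat(2)[OF L']] .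
    moreover have "E - G \<inter> sat L' = (E - (\<Union>i<n. S i)) \<union> (G - sat L')"
      unfolding G_def by auto
    ultimately have "measure M (E - G \<inter> sat L') = measure M (E - (\<Union>i<n. S i))"
      using sets_F_M[OF E] sets_F_M[OF S(1)] by (subst measure_Un_null_set[symmetric]) auto
    then show "measure M (E - G \<inter> sat L') < e" using n by simp
  qed (auto simp: G_def)
qed

end

section \<open>A binary tree of sets over a common point\<close>

text \<open>The tree is indexed by finite bit strings, and the loss allowed at a node depends on its
  code. All losses together have smaller measure than \<open>E0\<close>, so some point of
  \<open>E0\<close> is never lost.\<close>

lemma (in finite_measure) binary_tree_over_point:
  assumes start: "good L0 E0" "measure M E0 > 0"
    and meas: "\<And>L E. good L E \<Longrightarrow> E \<in> sets M"
    and step: "\<And>L E e. good L E \<Longrightarrow> e > 0 \<Longrightarrow>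
      \<exists>L1 L2 E'. good L1 E' \<and> good L2 E' \<and> L1 \<subseteq> L \<and> L2 \<subseteq> L \<and> L1 \<inter> L2 = {} \<and>
        E' \<subseteq> E \<and> measure M (E - E') < e"
  obtains x \<L> where "\<L> \<noteq> {}" "\<And>L. L \<in> \<L> \<Longrightarrow> \<exists>E. good L E \<and> x \<in> E"
    "\<And>L. L \<in> \<L> \<Longrightarrow> \<exists>L1\<in>\<L>. \<exists>L2\<in>\<L>. L1 \<subseteq> L \<and> L2 \<subseteq> L \<and> L1 \<inter> L2 = {}"
proof -
  obtain g1 g2 h where g: "\<And>L E e. good L E \<Longrightarrow> e > 0 \<Longrightarrow>
      good (g1 L E e) (h L E e) \<and> good (g2 L E e) (h L E e) \<and> g1 L E e \<subseteq> L \<and> g2 L E e \<subseteq> L \<and>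
      g1 L E e \<inter> g2 L E e = {} \<and> h L E e \<subseteq> E \<and> measure M (E - h L E e) < (e::real)"
    using step by metis
  \<comment> \<open>The shift by 2 makes the series sum to half of \<open>measure M E0\<close>,
    strictly below the available measure.\<close>
  define w where "w n = measure M E0 * (1/2) ^ (n + 2)" for n :: nat
  have wpos: "w n > 0" for n using start(2) by (simp add: w_def)
  \<comment> \<open>The head of the list is the most recent choice. It selects only the first
    component: both children receive the same second one.\<close>
  define node where "node = rec_list (L0, E0)
    (\<lambda>b s p. (if b then g1 (fst p) (snd p) (w (to_nat s)) else g2 (fst p) (snd p) (w (to_nat s)),
              h (fst p) (snd p) (w (to_nat s))))"
  define L where "L s = fst (node s)" for s :: "bool list"
  define E where "E s = snd (node s)" for s :: "bool list"
  have Nil: "L [] = L0" "E [] = E0" by (simp_all add: L_def E_def node_def)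
  have LE: "L (True # s) = g1 (L s) (E s) (w (to_nat s))" "L (False # s) = g2 (L s) (E s) (w (to_nat s))"
    "E (b # s) = h (L s) (E s) (w (to_nat s))" for b s
    by (simp_all add: L_def E_def node_def)
  have good: "good (L s) (E s)" for s
  proof (induction s)
    case (Cons b s)
    from g[OF this wpos] show ?case by (cases b) (auto simp: LE)
  qed (simp add: Nil start)
  note gs = g[OF good wpos]
  \<comment> \<open>\<open>B n\<close> is the loss at the node with code \<open>n\<close>, and empty
    when \<open>n\<close> is no code. The child \<open>True # s\<close> stands for both, as they
    share their second component.\<close>
  define B where "B n = (\<Union>s\<in>{s. to_nat s = n}. E s - E (True # s))" for n
  have Bn: "B n \<in> sets M \<and> measure M (B n) \<le> w n" for n
  proof (cases "\<exists>s :: bool list. to_nat s = n")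
    case True
    then obtain s :: "bool list" where s: "to_nat s = n" by auto
    then have "{s :: bool list. to_nat s = n} = {s}" by auto
    then have "B n = E s - E (True # s)" by (simp add: B_def)
    moreover have "E s - E (True # s) \<in> sets M" using meas[OF good] by (intro sets.Diff)
    ultimately show ?thesis using gs[of s "to_nat s"] s by (simp add: LE less_imp_le)
  next
    case False
    then have "B n = {}" by (auto simp: B_def)
    then show ?thesis using wpos[of n] by simp
  qed
  have wsum: "w sums (measure M E0 / 2)"
  proof -
    have "(\<lambda>n. (measure M E0 / 4) * (1/2) ^ n) sums ((measure M E0 / 4) * (1 / (1 - 1/2)))"
      by (intro sums_mult geometric_sums) auto
    then show ?thesis by (simp add: w_def[abs_def] field_simps)
  qed
  have Bsum: "summable (\<lambda>n. measure M (B n))"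
  proof (rule summable_comparison_test'[of w 0])
    show "summable w" using wsum by (rule sums_summable)
  qed (simp add: Bn)
  have "measure M (\<Union>n. B n) \<le> (\<Sum>n. measure M (B n))"
    using Bn Bsum by (intro finite_measure_subadditive_countably) auto
  also have "\<dots> \<le> (\<Sum>n. w n)"
    using Bn by (intro suminf_le Bsum sums_summable[OF wsum]) blast
  also have "\<dots> < measure M E0" using sums_unique[OF wsum] start(2) by simp
  finally have lt: "measure M (\<Union>n. B n) < measure M E0" .
  have "\<not> E0 \<subseteq> (\<Union>n. B n)"
  proof
    assume "E0 \<subseteq> (\<Union>n. B n)"
    then have "measure M E0 \<le> measure M (\<Union>n. B n)"
      using Bn by (intro finite_measure_mono) auto
    with lt show False by simp
  qed
  then obtain x where x: "x \<in> E0" "\<And>n. x \<notin> B n" by auto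
  have xE: "x \<in> E s" for s
  proof (induction s)
    case (Cons b s)
    have "x \<notin> E s - E (True # s)" using x(2)[of "to_nat s"] by (auto simp: B_def)
    then show ?case using Cons by (auto simp: LE)
  qed (simp add: Nil x)
  have tree: "L (True # s) \<subseteq> L s \<and> L (False # s) \<subseteq> L s \<and> L (True # s) \<inter> L (False # s) = {}" for s
    using gs[of s "to_nat s"] unfolding LE by blast
  show thesis
  proof (rule that[of "range L" x])
    fix K assume "K \<in> range L"
    then obtain s where s: "K = L s" by auto
    then show "\<exists>E. good K E \<and> x \<in> E" using good[of s] xE[of s] by auto
    show "\<exists>L1\<in>range L. \<exists>L2\<in>range L. L1 \<subseteq> K \<and> L2 \<subseteq> K \<and> L1 \<inter> L2 = {}"
      unfolding s using tree[of s] by (intro bexI[of _ "L (True # s)"] bexI[of _ "L (False # s)"]) auto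
  qed simp
qed

section \<open>Non-scattered closed sets\<close>

text \<open>A minimal closed subset of \<open>F\<close> meeting every member of \<open>\<L>\<close> has no isolated point, since the
  point could be dropped unless some \<open>L \<in> \<L>\<close> met the set in that point alone.\<close>

lemma not_scattered_if_disjoint_refinement:
  assumes cpt: "compact_space X" and F: "closedin X F"
    and ne: "\<L> \<noteq> {}" and clo: "\<And>L. L \<in> \<L> \<Longrightarrow> closedin X L"
    and meet: "\<And>L. L \<in> \<L> \<Longrightarrow> F \<inter> L \<noteq> {}"
    and split: "\<And>L. L \<in> \<L> \<Longrightarrow> \<exists>L1\<in>\<L>. \<exists>L2\<in>\<L>. L1 \<subseteq> L \<and> L2 \<subseteq> L \<and> L1 \<inter> L2 = {}"
  shows "\<not> scattered_space (subtopology X F)"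
proof
  assume sc: "scattered_space (subtopology X F)"
  \<comment> \<open>The minimal closed set is found through its complement: these are the open sets
    whose complement in \<open>F\<close> still meets every member of \<open>\<L>\<close>, and a
    maximal one is sought.\<close>
  define \<A> where "\<A> = {U. openin X U \<and> (\<forall>L\<in>\<L>. \<not> F \<inter> L \<subseteq> U)}"
  have "\<exists>U\<in>\<A>. \<forall>V\<in>\<A>. U \<subseteq> V \<longrightarrow> V = U"
  proof (rule subset_Zorn_nonempty)
    have "{} \<in> \<A>" unfolding \<A>_def using meet by auto
    then show "\<A> \<noteq> {}" by auto
    fix \<C> assume \<C>: "\<C> \<noteq> {}" "subset.chain \<A> \<C>"
    then have sub: "\<C> \<subseteq> \<A>" by (simp add: subset_chain_def)
    have "\<not> F \<inter> L \<subseteq> \<Union>\<C>" if L: "L \<in> \<L>" for L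
    proof
      assume cov: "F \<inter> L \<subseteq> \<Union>\<C>"
      \<comment> \<open>Compactness reduces a cover by the chain to finitely many members, whose
        union is one of them.\<close>
      have "compactin X (F \<inter> L)"
        using cpt F clo[OF L] by (simp add: closedin_compact_space closedin_Int)
      then obtain \<D> where \<D>: "finite \<D>" "\<D> \<subseteq> \<C>" "F \<inter> L \<subseteq> \<Union>\<D>"
        using cov sub unfolding compactin_def \<A>_def by (metis (no_types, lifting) mem_Collect_eq subset_iff)
      have "\<D> \<noteq> {}" using \<D>(3) meet[OF L] by auto
      then have "\<Union>\<D> \<in> \<C>"
        using \<D> \<C>(2) by (metis Union_in_chain subset_chain_def subset_iff)
      then show False using sub \<D>(3) L unfolding \<A>_def by blast
    qed
    moreover have "openin X (\<Union>\<C>)" using sub by (auto simp: \<A>_def)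
    ultimately show "\<Union>\<C> \<in> \<A>" by (auto simp: \<A>_def)
  qed
  then obtain U where U: "U \<in> \<A>" and max: "\<And>V. V \<in> \<A> \<Longrightarrow> U \<subseteq> V \<Longrightarrow> V = U" by blast
  define S where "S = F - U"
  have S: "S \<inter> L \<noteq> {}" if "L \<in> \<L>" for L using U that by (auto simp: S_def \<A>_def)
  then have "S \<noteq> {}" using ne by blast
  moreover have "S \<subseteq> topspace (subtopology X F)"
    using closedin_subset[OF F] by (auto simp: S_def)
  ultimately obtain x where x: "x \<in> S" "openin (subtopology (subtopology X F) S) {x}"
    using sc unfolding scattered_space_def by blast
  then obtain V where V: "openin X V" "{x} = V \<inter> (F \<inter> S)"
    unfolding subtopology_subtopology openin_subtopology by auto
  \<comment> \<open>Adding the isolating neighbourhood \<open>V\<close> to the maximal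
    \<open>U\<close> swallows some \<open>F \<inter> L\<close>, so \<open>S\<close> meets
    \<open>L\<close> in at most \<open>x\<close>. But \<open>S\<close> must meet two disjoint
    members of \<open>\<L>\<close> inside \<open>L\<close>.\<close>
  have "U \<union> V \<notin> \<A>" using max[of "U \<union> V"] x(1) V(2) by (auto simp: S_def)
  then obtain L where L: "L \<in> \<L>" "F \<inter> L \<subseteq> U \<union> V"
    using U V(1) by (auto simp: \<A>_def)
  then have "S \<inter> L \<subseteq> {x}" unfolding V(2) by (auto simp: S_def)
  moreover obtain L1 L2 where "L1 \<in> \<L>" "L2 \<in> \<L>" "L1 \<subseteq> L" "L2 \<subseteq> L" "L1 \<inter> L2 = {}"
    using split[OF L(1)] by blast
  ultimately show False using S by blast
qed

section \<open>Saturations of closed sets in the pulled-back \<open>\<sigma>\<close>-algebra\<close>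

lemma closedin_fibre_coordinate:
  assumes "continuous_map K cantor_space f"
  shows "closedin K {x \<in> topspace K. f x i = c}"
proof -
  have "continuous_map K (discrete_topology UNIV) (\<lambda>x. f x i)"
    using assms unfolding cantor_space_def continuous_map_componentwise_UNIV by blast
  from closedin_continuous_map_preimage[OF this, of "{c}"] show ?thesis by simp
qed

lemma closedin_fibre:
  assumes "continuous_map K cantor_space f"
  shows "closedin K {x \<in> topspace K. f x = t}"
proof -
  have "{x \<in> topspace K. f x = t} = (\<Inter>i. {x \<in> topspace K. f x i = t i})" by auto
  then show ?thesis using closedin_fibre_coordinate[OF assms] by (simp add: closedin_INT)
qed

text \<open>The saturation is the intersection over \<open>n\<close> of the sets of points that
  agree with some point of \<open>L\<close> in the first \<open>n\<close> coordinates. Compactness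
  of \<open>L\<close> supplies a single point of \<open>L\<close> that works for all
  \<open>n\<close>.\<close>

lemma saturation_in_sigma:
  assumes cpt: "compact_space K" and f: "continuous_map K cantor_space f"
    and L: "closedin K L"
  shows "{x \<in> topspace K. \<exists>y\<in>L. f y = f x}
    \<in> sigma_sets (topspace K) (range (\<lambda>i. {x \<in> topspace K. f x i}))"
proof -
  define N where "N = sigma (topspace K) (range (\<lambda>i. {x \<in> topspace K. f x i}))"
  have N: "space N = topspace K"
    "sets N = sigma_sets (topspace K) (range (\<lambda>i. {x \<in> topspace K. f x i}))"
    unfolding N_def by (auto intro!: sets_measure_of space_measure_of)
  have [measurable]: "Measurable.pred N (\<lambda>x. f x i)" for i
    unfolding pred_def N by (intro sigma_sets.Basic) auto
  have level: "{x \<in> space N. \<exists>y\<in>L. \<forall>i<n. f y i = f x i} \<in> sets N" for n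
  proof -
    \<comment> \<open>The possibly uncountable union over \<open>L\<close> becomes one over the
      prefixes that occur, and lists of booleans are countable.\<close>
    have "{x \<in> space N. \<exists>y\<in>L. \<forall>i<n. f y i = f x i} =
      (\<Union>q\<in>(\<lambda>y. map (f y) [0..<n]) ` L. {x \<in> space N. \<forall>i<n. q ! i = f x i})"
      by auto
    also have "\<dots> \<in> sets N" by (intro sets.countable_UN') auto
    finally show ?thesis .
  qed
  have "{x \<in> space N. \<exists>y\<in>L. f y = f x} = (\<Inter>n. {x \<in> space N. \<exists>y\<in>L. \<forall>i<n. f y i = f x i})"
  proof (intro equalityI subsetI)
    fix x assume x: "x \<in> (\<Inter>n. {x \<in> space N. \<exists>y\<in>L. \<forall>i<n. f y i = f x i})"
    define C where "C n = L \<inter> (\<Inter>i\<in>{..<n}. {y \<in> topspace K. f y i = f x i}) " for n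
    have C: "C n = {y \<in> L. \<forall>i<n. f y i = f x i}" for n
      using closedin_subset[OF L] by (auto simp: C_def)
    have "(\<Inter>n. C n) \<noteq> {}"
    proof (rule compact_space_imp_nest[OF cpt])
      show "closedin K (C n)" for n
      \<comment> \<open>For \<open>n = 0\<close> the intersection over the empty index set is
        \<open>UNIV\<close>, which need not be closed in \<open>K\<close>.\<close>
      proof (cases "n = 0")
        case False
        then show ?thesis unfolding C_def
          by (intro closedin_Int L closedin_INT closedin_fibre_coordinate[OF f]) auto
      qed (simp add: C_def L)
      show "C n \<noteq> {}" for n using x by (auto simp: C)
      show "decseq C" by (auto simp: C decseq_def)
    qed
    then obtain y where "\<And>n. y \<in> C n" by blast
    then have "y \<in> L" "f y = f x" by (auto simp: C)
    then show "x \<in> {x \<in> space N. \<exists>y\<in>L. f y = f x}" using x by auto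
  next
    fix x assume "x \<in> {x \<in> space N. \<exists>y\<in>L. f y = f x}"
    then obtain y where "x \<in> space N" "y \<in> L" "f y = f x" by blast
    then show "x \<in> (\<Inter>n. {x \<in> space N. \<exists>y\<in>L. \<forall>i<n. f y i = f x i})" by (auto intro!: bexI[of _ y])
  qed
  also have "\<dots> \<in> sets N" using level by auto
  finally show ?thesis by (simp add: N)
qed

lemma radon_prob_measure_inner_regular:
  assumes "radon_prob_measure X M" and A: "A \<in> sets M" and "e > 0"
  shows "\<exists>L. compactin X L \<and> L \<in> sets M \<and> L \<subseteq> A \<and> measure M (A - L) < e"
proof (cases "emeasure M A = 0")
  \<comment> \<open>A null \<open>A\<close> is treated apart because \<open>ennreal\<close>
    truncates \<open>measure M A - e\<close> to 0, which would spoil the strict inequality used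
    below.\<close>
  case True
  then show ?thesis using \<open>e > 0\<close> by (intro exI[of _ "{}"]) (auto simp: measure_def)
next
  case False
  interpret prob_space M using assms(1) by (simp add: radon_prob_measure_def)
  have "ennreal (measure M A - e) < ennreal (measure M A)"
    using False \<open>e > 0\<close> by (intro ennreal_lessI) (auto simp: emeasure_eq_measure less_le)
  also have "\<dots> = (SUP C\<in>{C. compactin X C \<and> C \<in> sets M \<and> C \<subseteq> A}. emeasure M C)"
    using assms(1) A unfolding radon_prob_measure_def emeasure_eq_measure[symmetric] by blast
  finally obtain C where C: "compactin X C" "C \<in> sets M" "C \<subseteq> A"
    "ennreal (measure M A - e) < emeasure M C"
    unfolding less_SUP_iff by blast
  then have "measure M A - e < measure M C"
    unfolding emeasure_eq_measure by (meson ennreal_leI not_le)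
  then have "measure M (A - C) < e" using A C by (simp add: finite_measure_Diff)
  with C show ?thesis by blast
qed

section \<open>Growing a tree of compact sets over one fibre\<close>

theorem theorem3p1:
  fixes K :: "'a topology" and M :: "'a measure" and f :: "'a \<Rightarrow> nat \<Rightarrow> bool"
  assumes "compact_space K" and "Hausdorff_space K" and "zerodimensional_space K"
    and "radon_prob_measure K M" and "\<not> separable_measure M"
    and "continuous_map K cantor_space f"
  shows "\<exists>t\<in>topspace cantor_space.
    \<not> scattered_space (subtopology K {x \<in> topspace K. f x = t})"
proof -
  have M: "prob_space M" "space M = topspace K"
    "sets M = sigma_sets (topspace K) {U. openin K U}"
    using assms(4) by (auto simp: radon_prob_measure_def)
  interpret prob_space M by (rule M(1))
  have closed_M: "A \<in> sets M" if "closedin K A" for A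
  proof -
    have "topspace K - A \<in> sets M" unfolding M(3) using that by (intro sigma_sets.Basic) auto
    then have "space M - (topspace K - A) \<in> sets M" by auto
    moreover have "space M - (topspace K - A) = A" using closedin_subset[OF that] M(2) by auto
    ultimately show ?thesis by simp
  qed
  \<comment> \<open>Preimages of a countable family of clopen sets which, with their complements,
    form a subbase of the Cantor space; they generate the pulled-back Borel \<sigma>-algebra
    \<open>F\<close>.\<close>
  define \<U> where "\<U> = range (\<lambda>i. {x \<in> topspace K. f x i})"
  define F where "F = sigma (topspace K) \<U>"
  have F: "space F = topspace K" "sets F = sigma_sets (topspace K) \<U>"
    unfolding F_def \<U>_def by (auto intro!: sets_measure_of space_measure_of)
  have \<U>M: "\<U> \<subseteq> sets M"
    using closed_M closedin_fibre_coordinate[OF assms(6), of _ True] by (auto simp: \<U>_def)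
  then have "sets F \<subseteq> sets M"
    unfolding F using M(2) sets.sigma_sets_subset by metis
  then interpret finite_measure_subalgebra M F
    by unfold_locales (simp add: subalgebra_def F M(2))
  obtain C where C: "C \<in> sets M" "C \<notin> null_sets M"
    and atomless: "\<And>D. D \<in> sets M \<Longrightarrow> D \<subseteq> C \<Longrightarrow> D \<notin> null_sets M \<Longrightarrow>
           \<exists>A\<in>sets M. A \<subseteq> D \<and> (\<forall>E\<in>sets F. sym_diff A (D \<inter> E) \<notin> null_sets M)"
    using nonseparable_relatively_atomless_part[OF assms(5) _ \<U>M] F M(2)
    by (auto simp: \<U>_def)
  define \<C> where "\<C> = {L. compactin K L \<and> L \<in> sets M}"
  define sat where "sat L = {x \<in> topspace K. \<exists>y\<in>L. f y = f x}" for L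
  have clo: "closedin K L" if "L \<in> \<C>" for L
    using that compactin_imp_closedin[OF assms(2)] by (simp add: \<C>_def)
  have \<C>: "\<C> \<subseteq> sets M" "{} \<in> \<C>" "\<And>K L. K \<in> \<C> \<Longrightarrow> L \<in> \<C> \<Longrightarrow> K \<union> L \<in> \<C>"
    by (auto simp: \<C>_def compactin_Un)
  have reg: "\<exists>L\<in>\<C>. L \<subseteq> A \<and> measure M (A - L) < e" if "A \<in> sets M" "e > 0" for A e
    using radon_prob_measure_inner_regular[OF assms(4) that] by (auto simp: \<C>_def)
  have sat: "sat L \<in> sets F" "L \<subseteq> sat L" if "L \<in> \<C>" for L
    using saturation_in_sigma[OF assms(1,6) clo[OF that]] closedin_subset[OF clo[OF that]]
    by (auto simp: sat_def F \<U>_def)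
  have inner: "\<exists>L E'. L \<in> \<C> \<and> L \<subseteq> A \<and> E' \<in> sets F \<and> E' \<subseteq> E \<and> E' \<subseteq> sat L \<and>
      covers M F L E' \<and> measure M (E - E') < e"
    if "A \<in> sets M" "E \<in> sets F" "covers M F A E" "e > 0" for A E e
    by (rule covers_inner_regular[of \<C> sat A E e]) (use \<C> reg sat that in blast)+
  \<comment> \<open>Covering is what lets \<open>L\<close> be split again, while
    \<open>E \<subseteq> sat L\<close> makes every fibre through a point of \<open>E\<close> really
    meet \<open>L\<close>, without exceptional null sets.\<close>
  define good where
    "good L E \<longleftrightarrow> L \<in> \<C> \<and> L \<subseteq> C \<and> E \<in> sets F \<and> E \<subseteq> sat L \<and> covers M F L E" for L E
  have step: "\<exists>L1 L2 E'. good L1 E' \<and> good L2 E' \<and> L1 \<subseteq> L \<and> L2 \<subseteq> L \<and> L1 \<inter> L2 = {} \<and>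
        E' \<subseteq> E \<and> measure M (E - E') < e" if LE: "good L E" and "e > 0" for L E e
  proof -
    have L: "L \<in> sets M" "L \<subseteq> C" "E \<in> sets F" "covers M F L E"
      using LE \<C>(1) by (auto simp: good_def)
    obtain A where A: "A \<in> sets M" "A \<subseteq> L" "covers M F A E" "covers M F (L - A) E"
    proof (rule covers_split[OF _ L(1,3,4)])
      show "\<exists>A\<in>sets M. A \<subseteq> D \<and> (\<forall>E\<in>sets F. sym_diff A (D \<inter> E) \<notin> null_sets M)"
        if "D \<in> sets M" "D \<subseteq> L" "D \<notin> null_sets M" for D
        using atomless[of D] that L(2) by blast
    qed
    \<comment> \<open>The two halves of \<open>L\<close> are shrunk to compact sets separately, each
      losing less than \<open>e / 2\<close> of \<open>E\<close>; the intersection of what remains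
      serves both.\<close>
    have "e / 2 > 0" using \<open>e > 0\<close> by simp
    obtain L1 E1 where 1: "L1 \<in> \<C>" "L1 \<subseteq> A" "E1 \<in> sets F" "E1 \<subseteq> E" "E1 \<subseteq> sat L1"
      "covers M F L1 E1" "measure M (E - E1) < e / 2"
      using inner[OF A(1) L(3) A(3) \<open>e / 2 > 0\<close>] by blast
    have "L - A \<in> sets M" using L A by auto
    obtain L2 E2 where 2: "L2 \<in> \<C>" "L2 \<subseteq> L - A" "E2 \<in> sets F" "E2 \<subseteq> E" "E2 \<subseteq> sat L2"
      "covers M F L2 E2" "measure M (E - E2) < e / 2"
      using inner[OF \<open>L - A \<in> sets M\<close> L(3) A(4) \<open>e / 2 > 0\<close>] by blast
    have "measure M (E - (E1 \<inter> E2)) \<le> measure M (E - E1) + measure M (E - E2)"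
      unfolding Diff_Int using sets_F_M L(3) 1(3) 2(3) by (intro measure_Un_le) auto
    then have "measure M (E - (E1 \<inter> E2)) < e" using 1(7) 2(7) by linarith
    moreover have "good L1 (E1 \<inter> E2)"
      unfolding good_def using 1 2(3) L(2) A(2) covers_subset[OF 1(6)] by auto
    moreover have "good L2 (E1 \<inter> E2)"
      unfolding good_def using 2 1(3) L(2) A(2) covers_subset[OF 2(6)] by auto
    ultimately show ?thesis using 1(2,4) 2(2) A(2)
      by (intro exI[of _ L1] exI[of _ L2] exI[of _ "E1 \<inter> E2"]) auto
  qed
  obtain S where S: "S \<in> sets F" "C - S \<in> null_sets M" "covers M F C S"
    using exists_support[OF C(1)] .
  have "S \<notin> null_sets M"
  proof
    assume "S \<in> null_sets M"
    with S(2) have "(C - S) \<union> S \<in> null_sets M" by (rule null_sets.Un)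
    then have "C \<in> null_sets M" by (rule null_sets_subset) (use C(1) in auto)
    with C(2) show False ..
  qed
  then have "measure M S > 0"
    using sets_F_M[OF S(1)] by (auto simp: null_sets_def emeasure_eq_measure zero_less_measure_iff)
  \<comment> \<open>The tolerance \<open>measure M S\<close> is just small enough to keep
    \<open>E0\<close> of positive measure.\<close>
  then obtain L0 E0 where 0: "L0 \<in> \<C>" "L0 \<subseteq> C" "E0 \<in> sets F" "E0 \<subseteq> S" "E0 \<subseteq> sat L0"
      "covers M F L0 E0" "measure M (S - E0) < measure M S"
    using inner[OF C(1) S(1) S(3)] by blast
  then have "good L0 E0" "measure M E0 > 0"
    using sets_F_M S(1) by (auto simp: good_def finite_measure_Diff)
  moreover have "E \<in> sets M" if "good L E" for L E using that sets_F_M by (simp add: good_def)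
  ultimately obtain x \<L> where \<L>: "\<L> \<noteq> {}" "\<And>L. L \<in> \<L> \<Longrightarrow> \<exists>E. good L E \<and> x \<in> E"
    "\<And>L. L \<in> \<L> \<Longrightarrow> \<exists>L1\<in>\<L>. \<exists>L2\<in>\<L>. L1 \<subseteq> L \<and> L2 \<subseteq> L \<and> L1 \<inter> L2 = {}"
    using step by (rule binary_tree_over_point[of good L0 E0]) blast+
  \<comment> \<open>The common point \<open>x\<close> lies in \<open>sat L\<close> for every
    \<open>L\<close> of the tree, so each \<open>L\<close> has a point in the fibre through
    \<open>x\<close>.\<close>
  have "\<not> scattered_space (subtopology K {y \<in> topspace K. f y = f x})"
  proof (rule not_scattered_if_disjoint_refinement[OF assms(1) closedin_fibre[OF assms(6)] \<L>(1)])
    fix L assume "L \<in> \<L>"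
    then obtain E where E: "good L E" "x \<in> E" using \<L>(2) by blast
    then show "closedin K L" using clo by (simp add: good_def)
    from closedin_subset[OF this] show "{y \<in> topspace K. f y = f x} \<inter> L \<noteq> {}"
      using E unfolding good_def sat_def by blast
  qed (rule \<L>(3))
  then show ?thesis by (auto simp: cantor_space_def)
qed

end
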